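(* Let $X=\ell_p(\mathbb N)$ with $p\in[1,+\infty)$, or $X=c_0(\mathbb N)$. Let $\alpha\in(0,1]$, let $(w(a))_{a>0}$ be the family of weights defined by $w_1(a)\cdots w_n(a)=\exp(an^\alpha)$ for all $n\ge1$ and all $a>0$, let $d\ge 1$ and let $\Lambda\subset(0,+\infty)^d$. If the family $(B_{w(\lambda(1))}\times\cdots\times B_{w(\lambda(d))})_{\lambda\in\Lambda}$ admits a common hypercyclic vector in $X^d$, then $\dim_{\mathcal H}(\Lambda)\le 1/\alpha$.
   Context: $(e_n)_{n\ge0}$ is the canonical basis of $X$. For a sequence $w=(w_n)_{n\ge1}$ of positive numbers, $B_w$ is the weighted backward shift on $X$: $B_we_0=0$ and $B_we_n=w_ne_{n-1}$ for $n\ge1$. Products of operators act coordinatewise on $X^d$. For $\lambda\in\mathbb R^d$ write $\lambda=(\lambda(1),\dots,\lambda(d))$. A vector is hypercyclic for an operator $T$ if its orbit $\{T^nx:n\ge0\}$ is dense; a common hypercyclic vector for a family is a vector hypercyclic for every member of the family. $\dim_{\mathcal H}$ denotes Hausdorff dimension. *)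

theory Defs
  imports "HOL-Analysis.Analysis"
begin

subsection \<open>The sequence spaces\<close>

text \<open>
  Scalars range over a type of class \<^class>\<open>real_normed_field\<close>: by the Gelfand-Mazur
  theorem these are exactly the real and the complex numbers, up to isomorphism.
\<close>

definition lp :: "real \<Rightarrow> (nat \<Rightarrow> 'k::real_normed_field) set" where
  "lp p = {x. summable (\<lambda>n. norm (x n) powr p)}"

definition lp_norm :: "real \<Rightarrow> (nat \<Rightarrow> 'k::real_normed_field) \<Rightarrow> real" where
  "lp_norm p x = (\<Sum>n. norm (x n) powr p) powr (1 / p)"

definition lp_topology :: "real \<Rightarrow> (nat \<Rightarrow> 'k::real_normed_field) topology" where
  "lp_topology p = Metric_space.mtopology (lp p) (\<lambda>x y. lp_norm p (\<lambda>n. x n - y n))"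

definition c0 :: "(nat \<Rightarrow> 'k::real_normed_field) set" where
  "c0 = {x. x \<longlonglongrightarrow> 0}"

text \<open>
  The locale \<^locale>\<open>Metric_space\<close> asks for a nonnegative distance on the whole type, and the
  supremum of an unbounded set of reals is unspecified; hence the value 0 off the space.
\<close>

definition c0_norm :: "(nat \<Rightarrow> 'k::real_normed_field) \<Rightarrow> real" where
  "c0_norm x = (if x \<in> c0 then (SUP n. norm (x n)) else 0)"

definition c0_topology :: "(nat \<Rightarrow> 'k::real_normed_field) topology" where
  "c0_topology = Metric_space.mtopology c0 (\<lambda>x y. c0_norm (\<lambda>n. x n - y n))"

lemma powr_convex_nonneg:
  fixes a b s t p :: real
  assumes "p \<ge> 1" "a \<ge> 0" "b \<ge> 0" "s > 0" "t > 0" "s + t = 1"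
  shows "(s * a + t * b) powr p \<le> s * a powr p + t * b powr p"
proof -
  have le: "c powr p \<le> c" if "0 < c" "c \<le> 1" for c :: real
    using powr_mono'[of 1 p c] that assms(1) by simp
  consider "a = 0" | "b = 0" | "a > 0" "b > 0"
    using assms by linarith
  then show ?thesis
  proof cases
    case 1
    then show ?thesis using assms le[of t] by (simp add: powr_mult mult_right_mono)
  next
    case 2
    then show ?thesis using assms le[of s] by (simp add: powr_mult mult_right_mono)
  next
    case 3
    have s: "1 - t = s" using assms by simp
    show ?thesis
      using convex_onD[OF powr_convex[OF assms(1)], of t a b] 3 assms unfolding s by simp
  qed
qed

lemma lp_minkowski:
  fixes x y :: "nat \<Rightarrow> 'k::real_normed_field"
  assumes p: "p \<ge> 1" and x: "x \<in> lp p" and y: "y \<in> lp p"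
  shows "(\<lambda>n. x n + y n) \<in> lp p"
    and "lp_norm p (\<lambda>n. x n + y n) \<le> lp_norm p x + lp_norm p y"
proof -
  have key: "(\<lambda>n. x n + y n) \<in> lp p \<and> lp_norm p (\<lambda>n. x n + y n) \<le> a + b"
    if a: "a > lp_norm p x" and b: "b > lp_norm p y" for a b
  proof -
    have a0: "a > 0" and b0: "b > 0"
      using a b unfolding lp_norm_def by (meson le_less_trans powr_ge_zero)+
    have root: "(\<Sum>n. norm (z n) powr p) \<le> c powr p"
      if "z \<in> lp p" "lp_norm p z < c" for z :: "nat \<Rightarrow> 'k" and c
    proof -
      have "0 \<le> (\<Sum>n. norm (z n) powr p)"
        using that by (intro suminf_nonneg) (auto simp: lp_def)
      then have "(\<Sum>n. norm (z n) powr p) = lp_norm p z powr p"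
        using p by (simp add: lp_norm_def powr_powr)
      also have "\<dots> \<le> c powr p"
        using that p by (intro powr_mono2) (auto simp: lp_norm_def)
      finally show ?thesis .
    qed
    define s where "s = a / (a + b)"
    define t where "t = b / (a + b)"
    have st: "s > 0" "t > 0" "s + t = 1"
      using a0 b0 by (auto simp: s_def t_def add_divide_distrib[symmetric])
    define f where "f n = (a + b) powr p * (s * (norm (x n) powr p / a powr p) + t * (norm (y n) powr p / b powr p))" for n
    have bound: "norm (x n + y n) powr p \<le> f n" for n
    proof -
      have "norm (x n + y n) \<le> (a + b) * (s * (norm (x n) / a) + t * (norm (y n) / b))"
      proof -
        have "(a + b) * (s * (norm (x n) / a) + t * (norm (y n) / b)) = norm (x n) + norm (y n)"
          using a0 b0 add_pos_pos[OF a0 b0] by (simp add: s_def t_def distrib_left)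
        then show ?thesis
          using norm_triangle_ineq[of "x n" "y n"] by simp
      qed
      then have "norm (x n + y n) powr p \<le> ((a + b) * (s * (norm (x n) / a) + t * (norm (y n) / b))) powr p"
        using p by (intro powr_mono2) auto
      also have "\<dots> = (a + b) powr p * (s * (norm (x n) / a) + t * (norm (y n) / b)) powr p"
        by (rule powr_mult)
      also have "\<dots> \<le> (a + b) powr p * (s * (norm (x n) / a) powr p + t * (norm (y n) / b) powr p)"
        using a0 b0 st p by (intro mult_left_mono powr_convex_nonneg) auto
      also have "\<dots> = f n"
        using a0 b0 by (simp add: f_def powr_divide)
      finally show ?thesis .
    qed
    have fs: "f sums ((a + b) powr p * (s * ((\<Sum>n. norm (x n) powr p) / a powr p) + t * ((\<Sum>n. norm (y n) powr p) / b powr p)))"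
      unfolding f_def using x y
      by (intro sums_mult sums_add sums_divide summable_sums) (auto simp: lp_def)
    have sm: "summable (\<lambda>n. norm (x n + y n) powr p)"
      by (rule summable_comparison_test'[OF sums_summable[OF fs], of 0]) (use bound in auto)
    have "(\<Sum>n. norm (x n + y n) powr p) \<le> suminf f"
      using bound sm sums_summable[OF fs] by (intro suminf_le) auto
    also have "suminf f = (a + b) powr p * (s * ((\<Sum>n. norm (x n) powr p) / a powr p) + t * ((\<Sum>n. norm (y n) powr p) / b powr p))"
      using fs by (simp add: sums_iff)
    also have "\<dots> \<le> (a + b) powr p * (s * 1 + t * 1)"
      using root[OF x a] root[OF y b] a0 b0 st
      by (intro mult_left_mono add_mono) (auto simp: divide_le_eq)
    finally have le: "(\<Sum>n. norm (x n + y n) powr p) \<le> (a + b) powr p"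
      using st by simp
    have "lp_norm p (\<lambda>n. x n + y n) \<le> ((a + b) powr p) powr (1 / p)"
      unfolding lp_norm_def using le p sm by (intro powr_mono2 suminf_nonneg) auto
    also have "\<dots> = a + b"
      using a0 b0 p by (simp add: powr_powr)
    finally show ?thesis using sm by (simp add: lp_def)
  qed
  show "(\<lambda>n. x n + y n) \<in> lp p"
    using key[of "lp_norm p x + 1" "lp_norm p y + 1"] by simp
  show "lp_norm p (\<lambda>n. x n + y n) \<le> lp_norm p x + lp_norm p y"
  proof (rule field_le_epsilon)
    fix e :: real assume "e > 0"
    then show "lp_norm p (\<lambda>n. x n + y n) \<le> lp_norm p x + lp_norm p y + e"
      using key[of "lp_norm p x + e / 2" "lp_norm p y + e / 2"] by simp
  qed
qed

lemma lp_diff: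
  assumes "p \<ge> 1" "x \<in> lp p" "y \<in> lp p"
  shows "(\<lambda>n. x n - y n) \<in> lp p"
  using lp_minkowski(1)[of p x "\<lambda>n. - y n"] assms by (simp add: lp_def)

lemma Metric_space_lp:
  assumes p: "p \<ge> 1"
  shows "Metric_space (lp p) (\<lambda>x y. lp_norm p (\<lambda>n. x n - y n :: 'k::real_normed_field))"
proof
  fix x y z :: "nat \<Rightarrow> 'k"
  show "0 \<le> lp_norm p (\<lambda>n. x n - y n)"
    by (simp add: lp_norm_def)
  show "lp_norm p (\<lambda>n. x n - y n) = lp_norm p (\<lambda>n. y n - x n)"
    by (simp add: lp_norm_def norm_minus_commute)
  assume x: "x \<in> lp p" and y: "y \<in> lp p"
  have sm: "summable (\<lambda>n. norm (x n - y n) powr p)"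
    using lp_diff[OF p x y] by (simp add: lp_def)
  show "lp_norm p (\<lambda>n. x n - y n) = 0 \<longleftrightarrow> x = y"
    using suminf_eq_zero_iff[OF sm] p by (auto simp: lp_norm_def fun_eq_iff)
  assume z: "z \<in> lp p"
  show "lp_norm p (\<lambda>n. x n - z n) \<le> lp_norm p (\<lambda>n. x n - y n) + lp_norm p (\<lambda>n. y n - z n)"
    using lp_minkowski(2)[OF p lp_diff[OF p x y] lp_diff[OF p y z]] by simp
qed

lemma c0_diff:
  assumes "x \<in> c0" "y \<in> c0"
  shows "(\<lambda>n. x n - y n) \<in> c0"
  using assms tendsto_diff[of x 0 sequentially y 0] by (simp add: c0_def)

lemma norm_le_c0_norm:
  assumes "x \<in> c0"
  shows "norm (x n) \<le> c0_norm x"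
proof -
  have "Bseq x"
    using assms by (auto simp: c0_def intro: convergent_imp_Bseq convergentI)
  then have "bdd_above (range (\<lambda>n. norm (x n)))"
    by (auto simp: Bseq_def bdd_above_def)
  then show ?thesis
    using assms by (auto simp: c0_norm_def intro: cSUP_upper)
qed

lemma c0_norm_least:
  assumes "x \<in> c0" "\<And>n. norm (x n) \<le> c"
  shows "c0_norm x \<le> c"
  using assms by (auto simp: c0_norm_def intro: cSUP_least)

lemma Metric_space_c0:
  "Metric_space c0 (\<lambda>x y. c0_norm (\<lambda>n. x n - y n :: 'k::real_normed_field))"
proof
  fix x y z :: "nat \<Rightarrow> 'k"
  show "0 \<le> c0_norm (\<lambda>n. x n - y n)"
    using order_trans[OF norm_ge_zero norm_le_c0_norm[of "\<lambda>n. x n - y n"]]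
    by (cases "(\<lambda>n. x n - y n) \<in> c0") (blast, simp add: c0_norm_def)
  have "(\<lambda>n. x n - y n) \<in> c0 \<longleftrightarrow> (\<lambda>n. y n - x n) \<in> c0"
    using tendsto_minus_cancel_left[of "\<lambda>n. x n - y n" 0 sequentially] by (simp add: c0_def)
  then show "c0_norm (\<lambda>n. x n - y n) = c0_norm (\<lambda>n. y n - x n)"
    by (simp add: c0_norm_def norm_minus_commute)
  assume x: "x \<in> c0" and y: "y \<in> c0"
  show "c0_norm (\<lambda>n. x n - y n) = 0 \<longleftrightarrow> x = y"
  proof
    assume "c0_norm (\<lambda>n. x n - y n) = 0"
    then show "x = y"
      using norm_le_c0_norm[OF c0_diff[OF x y]] by (auto simp: fun_eq_iff)
  qed (simp add: c0_norm_def)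
  assume z: "z \<in> c0"
  show "c0_norm (\<lambda>n. x n - z n) \<le> c0_norm (\<lambda>n. x n - y n) + c0_norm (\<lambda>n. y n - z n)"
  proof (rule c0_norm_least[OF c0_diff[OF x z]])
    fix n
    show "norm (x n - z n) \<le> c0_norm (\<lambda>n. x n - y n) + c0_norm (\<lambda>n. y n - z n)"
      using norm_triangle_ineq[of "x n - y n" "y n - z n"]
        norm_le_c0_norm[OF c0_diff[OF x y], of n] norm_le_c0_norm[OF c0_diff[OF y z], of n]
      by simp
  qed
qed

lemma topspace_lp_topology: "p \<ge> 1 \<Longrightarrow> topspace (lp_topology p) = lp p"
  by (simp add: lp_topology_def Metric_space.topspace_mtopology Metric_space_lp)

lemma topspace_c0_topology: "topspace c0_topology = c0"
  by (simp add: c0_topology_def Metric_space.topspace_mtopology Metric_space_c0)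


subsection \<open>Weighted backward shifts and hypercyclic vectors\<close>

text \<open>
  A weight \<open>w\<close> is used at the indices \<open>n \<ge> 1\<close> only; \<open>w 0\<close> is irrelevant.
\<close>

definition backward_shift ::
    "(nat \<Rightarrow> real) \<Rightarrow> (nat \<Rightarrow> 'k::real_normed_field) \<Rightarrow> nat \<Rightarrow> 'k" where
  "backward_shift w x = (\<lambda>n. of_real (w (Suc n)) * x (Suc n))"

lemma backward_shift_basis:
  defines "e \<equiv> \<lambda>n k. if k = n then 1 else (0 :: 'k::real_normed_field)"
  shows "backward_shift w (e 0) = (\<lambda>k. 0)"
    and "n \<ge> 1 \<Longrightarrow> backward_shift w (e n) = (\<lambda>k. of_real (w n) * e (n - 1) k)"
  by (auto simp: backward_shift_def e_def fun_eq_iff)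

definition product_operator :: "('d \<Rightarrow> 'a \<Rightarrow> 'a) \<Rightarrow> ('d \<Rightarrow> 'a) \<Rightarrow> 'd \<Rightarrow> 'a" where
  "product_operator T x = (\<lambda>i. T i (x i))"

definition hypercyclic_vector :: "'a topology \<Rightarrow> ('a \<Rightarrow> 'a) \<Rightarrow> 'a \<Rightarrow> bool" where
  "hypercyclic_vector X T x \<longleftrightarrow>
     x \<in> topspace X \<and> X closure_of (range (\<lambda>n. (T ^^ n) x)) = topspace X"

definition common_hypercyclic_vector ::
    "'a topology \<Rightarrow> 'i set \<Rightarrow> ('i \<Rightarrow> 'a \<Rightarrow> 'a) \<Rightarrow> 'a \<Rightarrow> bool" where
  "common_hypercyclic_vector X I T x \<longleftrightarrow>
     x \<in> topspace X \<and> (\<forall>i\<in>I. hypercyclic_vector X (T i) x)"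


subsection \<open>Hausdorff dimension\<close>

text \<open>
  The gauge is the \<open>s\<close>-th power of the diameter, with the usual conventions that the empty
  set has gauge 0 and that the 0-th power of 0 is 1 (in contrast to \<open>powr\<close>), so that the
  0-dimensional measure counts points.  Covering sets are required to be bounded because
  \<^const>\<open>diameter\<close> is unspecified on unbounded sets.
\<close>

definition hausdorff_gauge :: "real \<Rightarrow> 'a::metric_space set \<Rightarrow> ennreal" where
  "hausdorff_gauge s U =
     (if U = {} then 0 else if s = 0 then 1 else ennreal (diameter U powr s))"

definition hausdorff_premeasure :: "real \<Rightarrow> real \<Rightarrow> 'a::metric_space set \<Rightarrow> ennreal" where
  "hausdorff_premeasure s \<delta> A =
     (INF U \<in> {U :: nat \<Rightarrow> 'a set. A \<subseteq> (\<Union>n. U n) \<and> (\<forall>n. bounded (U n) \<and> diameter (U n) \<le> \<delta>)}.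
        \<Sum>n. hausdorff_gauge s (U n))"

definition hausdorff_measure :: "real \<Rightarrow> 'a::metric_space set \<Rightarrow> ennreal" where
  "hausdorff_measure s A = (SUP \<delta> \<in> {0<..}. hausdorff_premeasure s \<delta> A)"

definition hausdorff_dim :: "'a::metric_space set \<Rightarrow> ennreal" where
  "hausdorff_dim A = (INF s \<in> {s. s \<ge> 0 \<and> hausdorff_measure s A = 0}. ennreal s)"

end

theory Submission
  imports Defs
begin

text \<open>
  Reading off the 0-th coordinates, the \<open>n\<close>-th iterate at parameter \<open>\<lambda>\<close> has moduli
  \<open>exp (\<lambda>(i) n\<^sup>\<alpha>) \<bar>u\<^sub>i(n)\<bar>\<close>.  The parameters for which all of these lie in the interval \<open>(1, 2)\<close>
  form a set of diameter \<open>O(n\<^sup>-\<^sup>\<alpha>)\<close>.  If \<open>u\<close> is a common hypercyclic vector, every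
  parameter belongs to infinitely many of these sets, which therefore cover \<open>\<Lambda>\<close> from any
  index on; and \<open>\<Sum>n. n\<^sup>-\<^sup>\<alpha>\<^sup>s\<close> converges for \<open>s > 1/\<alpha>\<close>.
\<close>

subsection \<open>Coordinates in the sequence spaces\<close>

lemma norm_le_lp_norm:
  assumes p: "p \<ge> 1" and x: "x \<in> lp p"
  shows "norm (x n) \<le> lp_norm p x"
proof -
  have "(\<Sum>k\<in>{n}. norm (x k) powr p) \<le> (\<Sum>k. norm (x k) powr p)"
    using x by (intro sum_le_suminf) (auto simp: lp_def)
  then have "(norm (x n) powr p) powr (1 / p) \<le> lp_norm p x"
    unfolding lp_norm_def using p by (intro powr_mono2) auto
  then show ?thesis
    using p by (simp add: powr_powr)
qed

text \<open>Serves \<open>lp\<close> and \<open>c0\<close> alike: in both norms the modulus of a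
  coordinate is 1-Lipschitz.\<close>

lemma (in Metric_space) continuous_map_mtopology_real:
  fixes f :: "'a \<Rightarrow> real"
  assumes "\<And>x y. x \<in> M \<Longrightarrow> y \<in> M \<Longrightarrow> \<bar>f y - f x\<bar> \<le> d x y"
  shows "continuous_map mtopology euclideanreal f"
  unfolding continuous_map topspace_mtopology
proof (intro conjI allI impI)
  fix S :: "real set" assume S: "openin euclideanreal S"
  show "openin mtopology {x \<in> M. f x \<in> S}"
    unfolding openin_mtopology
  proof (intro conjI allI impI)
    fix x assume x: "x \<in> {x \<in> M. f x \<in> S}"
    with S obtain e where e: "e > 0" "\<And>t. dist t (f x) < e \<Longrightarrow> t \<in> S"
      by (auto simp: open_dist)
    have "mball x e \<subseteq> {x \<in> M. f x \<in> S}"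
    proof
      fix y assume "y \<in> mball x e"
      then have "y \<in> M" "d x y < e" by auto
      then show "y \<in> {x \<in> M. f x \<in> S}"
        using assms[of x y] x by (auto intro!: e(2) simp: dist_real_def)
    qed
    with e show "\<exists>r>0. mball x r \<subseteq> {x \<in> M. f x \<in> S}" by blast
  qed auto
qed auto

lemma continuous_map_norm_coordinate:
  fixes X :: "(nat \<Rightarrow> 'k::real_normed_field) topology"
  assumes "(\<exists>p\<ge>1. X = lp_topology p) \<or> X = c0_topology"
  shows "continuous_map X euclideanreal (\<lambda>x. norm (x n))"
  using assms
proof (elim disjE exE conjE)
  fix p :: real assume p: "p \<ge> 1" and X: "X = lp_topology p"
  show ?thesis
    unfolding X lp_topology_def
  proof (rule Metric_space.continuous_map_mtopology_real[OF Metric_space_lp[OF p]])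
    fix x y :: "nat \<Rightarrow> 'k" assume "x \<in> lp p" "y \<in> lp p"
    then show "\<bar>norm (y n) - norm (x n)\<bar> \<le> lp_norm p (\<lambda>n. x n - y n)"
      using norm_le_lp_norm[OF p lp_diff[OF p], of x y n] norm_triangle_ineq3[of "x n" "y n"]
      by (simp add: abs_minus_commute)
  qed
next
  assume X: "X = c0_topology"
  show ?thesis
    unfolding X c0_topology_def
  proof (rule Metric_space.continuous_map_mtopology_real[OF Metric_space_c0])
    fix x y :: "nat \<Rightarrow> 'k" assume "x \<in> c0" "y \<in> c0"
    then show "\<bar>norm (y n) - norm (x n)\<bar> \<le> c0_norm (\<lambda>n. x n - y n)"
      using norm_le_c0_norm[OF c0_diff, of x y n] norm_triangle_ineq3[of "x n" "y n"]
      by (simp add: abs_minus_commute)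
  qed
qed

text \<open>Provides points of the space with a prescribed coordinate, so that the open sets an
  orbit has to meet are nonempty.\<close>

lemma single_mem_topspace:
  fixes X :: "(nat \<Rightarrow> 'k::real_normed_field) topology"
  assumes "(\<exists>p\<ge>1. X = lp_topology p) \<or> X = c0_topology"
  shows "(\<lambda>k. if k = n then c else 0) \<in> topspace X"
proof -
  have "(\<lambda>k. if k = n then c else 0) \<in> lp p" for p
    unfolding lp_def mem_Collect_eq by (rule summable_finite[of "{n}"]) auto
  moreover have "(\<lambda>k. if k = n then c else 0) \<in> c0"
    unfolding c0_def mem_Collect_eq
    by (rule tendsto_eventually) (use eventually_gt_at_top[of n] in eventually_elim, auto)
  ultimately show ?thesis
    using assms by (auto simp: topspace_lp_topology topspace_c0_topology)
qed

subsection \<open>Orbits of products of weighted shifts\<close>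

lemma funpow_product_operator:
  "(product_operator T ^^ n) x = (\<lambda>i. (T i ^^ n) (x i))"
  by (induction n) (auto simp: product_operator_def)

lemma funpow_backward_shift:
  "(backward_shift w ^^ n) x k = of_real (\<Prod>j=1..n. w (k + j)) * x (k + n)"
proof (induction n arbitrary: k)
  case (Suc n)
  \<comment> \<open>The outermost shift reads coordinate \<open>Suc k\<close> of the
    \<open>n\<close>-th iterate. Hence the first factor is split off, and \<open>k\<close> is
    arbitrary in the induction.\<close>
  have "(\<Prod>j=1..Suc n. w (k + j)) = w (Suc k) * (\<Prod>j=1..n. w (Suc k + j))"
    by (subst prod.atLeast_Suc_atMost) (auto simp: prod.shift_bounds_cl_Suc_ivl simp del: prod.cl_ivl_Suc)
  then show ?case
    by (simp add: backward_shift_def[of w "(backward_shift w ^^ n) x"] Suc mult_ac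
        del: prod.cl_ivl_Suc of_real_prod)
qed simp

lemma hypercyclic_vector_hits_open:
  assumes "hypercyclic_vector X T x" "openin X U" "U \<noteq> {}"
  obtains n where "(T ^^ n) x \<in> U"
proof -
  obtain y where y: "y \<in> U" using assms(3) by blast
  then have "y \<in> X closure_of (range (\<lambda>n. (T ^^ n) x))"
    using assms openin_subset unfolding hypercyclic_vector_def by blast
  then show ?thesis
    using that y assms(2) unfolding in_closure_of by blast
qed

lemma hypercyclic_vector_norm_coordinate_frequently:
  fixes X :: "(nat \<Rightarrow> 'k::real_normed_field) topology"
    and x :: "'d::finite \<Rightarrow> nat \<Rightarrow> 'k"
  assumes X: "(\<exists>p\<ge>1. X = lp_topology p) \<or> X = c0_topology"
    and hc: "hypercyclic_vector (product_topology (\<lambda>_::'d. X) UNIV) T x"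
    and r: "0 \<le> r" "r < s"
  shows "\<exists>n\<ge>N. \<forall>i. norm ((T ^^ n) x i k) \<in> {r<..<s}"
proof -
  text \<open>Deleting the finitely many moduli met before time \<open>N\<close> forces a visit at a later time.\<close>
  define F where "F = (\<lambda>(n, i). norm ((T ^^ n) x i k)) ` ({..<N} \<times> UNIV)"
  have F: "finite F" by (simp add: F_def)
  define S where "S = {r<..<s} - F"
  have S: "open S"
    unfolding S_def using F by (intro open_Diff finite_imp_closed) auto
  have "infinite S"
    unfolding S_def using F r by (simp add: infinite_Ioo)
  then obtain t where t: "t \<in> S"
    using infinite_imp_nonempty by blast
  define V where "V = {y \<in> topspace X. norm (y k) \<in> S}"
  have "openin X V"
    unfolding V_def
    using openin_continuous_map_preimage[OF continuous_map_norm_coordinate[OF X]] S by simp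
  \<comment> \<open>The box is open because the index type is finite. Using the same
    \<open>V\<close> in every factor lets one time \<open>n\<close> serve all
    \<open>i\<close>.\<close>
  then have "openin (product_topology (\<lambda>_::'d. X) UNIV) (PiE UNIV (\<lambda>_. V))"
    by (intro product_topology_basis) auto
  \<comment> \<open>Here \<open>0 \<le> r\<close> matters: \<open>t > r\<close> is then positive, so
    \<open>of_real t\<close> has modulus \<open>t\<close>.\<close>
  moreover have "(\<lambda>_ j. if j = k then of_real t else 0) \<in> PiE (UNIV :: 'd set) (\<lambda>_. V)"
    using t r single_mem_topspace[OF X, of k "of_real t"] by (auto simp: V_def S_def)
  ultimately obtain n where "(T ^^ n) x \<in> PiE UNIV (\<lambda>_. V)"
    using hypercyclic_vector_hits_open[OF hc] by blast
  then have n: "norm ((T ^^ n) x i k) \<in> S" for i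
    by (auto simp: V_def PiE_iff)
  have "n \<ge> N"
  proof (rule ccontr)
    assume "\<not> n \<ge> N"
    then have "norm ((T ^^ n) x i k) \<in> F" for i
      unfolding F_def by force
    then show False using n by (auto simp: S_def)
  qed
  then show ?thesis using n by (auto simp: S_def)
qed

subsection \<open>Hausdorff dimension of limsup sets\<close>

text \<open>The convergence half of Borel-Cantelli: each tail of \<open>V\<close> covers
  \<open>A\<close>, and its gauge sum is at most a tail of a convergent series. The distance bound
  starts at \<open>n = 1\<close> because the application has \<open>f 0 = 0\<close>, while
  \<open>V 0\<close> can be large.\<close>

lemma hausdorff_measure_limsup_eq_0:
  fixes A :: "'a::metric_space set"
  assumes s: "s > 0"
    and A: "\<And>N. A \<subseteq> (\<Union>n\<in>{N..}. V n)"
    and V: "\<And>n x y. n \<ge> 1 \<Longrightarrow> x \<in> V n \<Longrightarrow> y \<in> V n \<Longrightarrow> dist x y \<le> f n"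
    and f: "\<And>n. f n \<ge> 0" "f \<longlonglongrightarrow> 0" "summable (\<lambda>n. f n powr s)"
  shows "hausdorff_measure s A = 0"
proof -
  have "hausdorff_premeasure s \<delta> A \<le> 0" if \<delta>: "\<delta> > 0" for \<delta>
  proof (rule ennreal_le_epsilon)
    fix e :: real assume e: "e > 0"
    obtain N1 where N1: "\<And>n. n \<ge> N1 \<Longrightarrow> norm (\<Sum>i. f (i + n) powr s) < e"
      using suminf_exist_split[OF e f(3)] by blast
    obtain N2 where N2: "\<And>n. n \<ge> N2 \<Longrightarrow> f n < \<delta>"
      using order_tendstoD(2)[OF f(2) \<delta>] by (auto simp: eventually_at_top_linorder)
    \<comment> \<open>The three entries make the distance bound available, the tail sum less than
      \<open>e\<close>, and the diameters less than \<open>\<delta>\<close>.\<close>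
    define N where "N = max 1 (max N1 N2)"
    define U where "U n = V (n + N)" for n
    have dist: "dist x y \<le> f (n + N)" if "x \<in> U n" "y \<in> U n" for n x y
      using V[of "n + N" x y] that by (simp add: U_def N_def)
    have bdd: "bounded (U n)" for n
      using bounded_two_points dist by blast
    \<comment> \<open>The empty set has diameter 0 by convention, which is why \<open>f\<close> must
      be nonnegative.\<close>
    have diam: "diameter (U n) \<le> f (n + N)" for n
      unfolding diameter_def using dist f(1) by (auto intro!: cSUP_least)
    have cover: "A \<subseteq> (\<Union>n. U n)"
    proof
      fix x assume "x \<in> A"
      then obtain n where "n \<ge> N" "x \<in> V n" using A[of N] by blast
      then show "x \<in> (\<Union>n. U n)"
        by (auto simp: U_def intro!: exI[of _ "n - N"])
    qed
    have small: "diameter (U n) \<le> \<delta>" for n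
    proof -
      have "n + N \<ge> N2" by (simp add: N_def)
      then show ?thesis using diam[of n] N2[of "n + N"] by linarith
    qed
    have "hausdorff_premeasure s \<delta> A \<le> (\<Sum>n. hausdorff_gauge s (U n))"
      unfolding hausdorff_premeasure_def
      by (rule INF_lower) (use cover bdd small in auto)
    also have "\<dots> \<le> (\<Sum>n. ennreal (f (n + N) powr s))"
    proof (rule suminf_le)
      fix n
      have "diameter (U n) powr s \<le> f (n + N) powr s"
        using diam[of n] diameter_ge_0[OF bdd[of n]] s by (intro powr_mono2) auto
      then show "hausdorff_gauge s (U n) \<le> ennreal (f (n + N) powr s)"
        using s by (auto simp: hausdorff_gauge_def intro: ennreal_leI)
    qed auto
    also have "\<dots> = ennreal (\<Sum>n. f (n + N) powr s)"
      using summable_ignore_initial_segment[OF f(3)] by (intro suminf_ennreal2) auto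
    also have "\<dots> \<le> 0 + ennreal e"
    proof -
      have "N \<ge> N1" by (simp add: N_def)
      then show ?thesis using N1[of N] by (auto intro: ennreal_leI)
    qed
    finally show "hausdorff_premeasure s \<delta> A \<le> 0 + ennreal e" .
  qed
  then show ?thesis
    unfolding hausdorff_measure_def by (auto simp: SUP_eq_iff intro!: antisym SUP_least)
qed

text \<open>Nothing is known about the measure at the exponent \<open>c\<close> itself, so
  \<open>c\<close> is approached through \<open>c + e\<close>.\<close>

lemma hausdorff_dim_le:
  assumes "c \<ge> 0" "\<And>s. s > c \<Longrightarrow> hausdorff_measure s A = 0"
  shows "hausdorff_dim A \<le> ennreal c"
proof (rule ennreal_le_epsilon)
  fix e :: real assume "e > 0"
  then have "hausdorff_dim A \<le> ennreal (c + e)"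
    unfolding hausdorff_dim_def using assms by (intro INF_lower) auto
  then show "hausdorff_dim A \<le> ennreal c + ennreal e"
    using assms(1) \<open>e > 0\<close> by simp
qed

text \<open>The unknown factor \<open>c\<close> cancels in the quotient of the two values, which is
  less than 2. Then \<open>1 + t \<le> exp t\<close> gives \<open>t < 1\<close> for
  \<open>t = (a - b) * m\<close>, and by symmetry for its negative.\<close>

lemma abs_diff_le_if_exp_mult_in_interval:
  fixes a b m c :: real
  assumes "m > 0" "exp (a * m) * c \<in> {1<..<2}" "exp (b * m) * c \<in> {1<..<2}"
  shows "\<bar>a - b\<bar> \<le> 1 / m"
proof -
  have *: "(x - y) * m \<le> 1"
    if x: "exp (x * m) * c \<in> {1<..<2}" and y: "exp (y * m) * c \<in> {1<..<2}" for x y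
  proof -
    have "exp ((x - y) * m) * (exp (y * m) * c) = exp (x * m) * c"
      by (simp add: left_diff_distrib exp_diff)
    also have "\<dots> < 2 * (exp (y * m) * c)" using x y by simp
    finally have "exp ((x - y) * m) < 2"
      by (rule mult_right_less_imp_less) (use y in auto)
    then show ?thesis using exp_ge_add_one_self[of "(x - y) * m"] by linarith
  qed
  show ?thesis
    using *[OF assms(2,3)] *[OF assms(3,2)] assms(1) by (simp add: abs_le_iff field_simps)
qed

theorem corollary1p3:
  fixes X :: "(nat \<Rightarrow> 'k::real_normed_field) topology"
    and \<alpha> :: real
    and w :: "real \<Rightarrow> nat \<Rightarrow> real"
    and \<Lambda> :: "(real ^ 'd) set"
  assumes "(\<exists>p\<ge>1. X = lp_topology p) \<or> X = c0_topology"
    and "0 < \<alpha>" and "\<alpha> \<le> 1"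
    and "\<And>a n. a > 0 \<Longrightarrow> n \<ge> 1 \<Longrightarrow> w a n > 0"
    and "\<And>a n. a > 0 \<Longrightarrow> n \<ge> 1 \<Longrightarrow> (\<Prod>k=1..n. w a k) = exp (a * real n powr \<alpha>)"
    and "\<Lambda> \<subseteq> {l. \<forall>i. l $ i > 0}"
    and "\<exists>u. common_hypercyclic_vector (product_topology (\<lambda>_::'d. X) UNIV) \<Lambda>
               (\<lambda>l. product_operator (\<lambda>i. backward_shift (w (l $ i)))) u"
  shows "hausdorff_dim \<Lambda> \<le> ennreal (1 / \<alpha>)"
proof (rule hausdorff_dim_le)
  show "0 \<le> 1 / \<alpha>" using assms(2) by simp
next
  fix s :: real assume s: "s > 1 / \<alpha>"
  have s0: "s > 0" using s assms(2) by (meson less_trans zero_less_divide_1_iff)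
  obtain u where hc: "\<And>l. l \<in> \<Lambda> \<Longrightarrow> hypercyclic_vector (product_topology (\<lambda>_::'d. X) UNIV)
      (product_operator (\<lambda>i. backward_shift (w (l $ i)))) u"
    using assms(7) unfolding common_hypercyclic_vector_def by blast
  \<comment> \<open>At coordinate 0 the weight product starts at index 1, so it is exactly the
    prescribed one, available for \<open>n \<ge> 1\<close>.\<close>
  have orbit: "norm ((product_operator (\<lambda>i. backward_shift (w (l $ i))) ^^ n) u i 0)
      = exp (l $ i * real n powr \<alpha>) * norm (u i n)" if "l \<in> \<Lambda>" "n \<ge> 1" for l n i
  proof -
    have "l $ i > 0" using that assms(6) by blast
    then show ?thesis
      using assms(5)[of "l $ i" n] that
      by (simp add: funpow_product_operator funpow_backward_shift norm_mult)
  qed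
  define V where
    "V n = {l \<in> \<Lambda>. \<forall>i. exp (l $ i * real n powr \<alpha>) * norm (u i n) \<in> {1<..<2}}" for n
  \<comment> \<open>The factor \<open>CARD('d)\<close> comes from bounding the Euclidean distance by
    the sum of the coordinate distances, each at most
    \<open>1 / real n powr \<alpha>\<close>.\<close>
  define f where "f n = real CARD('d) * real n powr (- \<alpha>)" for n
  show "hausdorff_measure s \<Lambda> = 0"
  proof (rule hausdorff_measure_limsup_eq_0[OF s0])
    show "\<Lambda> \<subseteq> (\<Union>n\<in>{N..}. V n)" for N
    proof
      fix l assume l: "l \<in> \<Lambda>"
      \<comment> \<open>The 1 in the maximum makes \<open>orbit\<close> applicable.\<close>
      obtain n where "n \<ge> max 1 N"
        "\<And>i. norm ((product_operator (\<lambda>i. backward_shift (w (l $ i))) ^^ n) u i 0) \<in> {1<..<2}"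
        using hypercyclic_vector_norm_coordinate_frequently[OF assms(1) hc[OF l], of 1 2 "max 1 N" 0]
        by auto
      then show "l \<in> (\<Union>n\<in>{N..}. V n)"
        using l orbit[OF l, of n] by (auto simp: V_def)
    qed
  next
    fix n x y assume n: "n \<ge> (1 :: nat)" and x: "x \<in> V n" and y: "y \<in> V n"
    have "dist x y \<le> (\<Sum>i\<in>UNIV. \<bar>(x - y) $ i\<bar>)"
      unfolding dist_norm by (rule norm_le_l1_cart)
    also have "\<dots> \<le> (\<Sum>i\<in>(UNIV :: 'd set). 1 / real n powr \<alpha>)"
    proof (rule sum_mono)
      fix i
      show "\<bar>(x - y) $ i\<bar> \<le> 1 / real n powr \<alpha>"
        using abs_diff_le_if_exp_mult_in_interval[of "real n powr \<alpha>" "x $ i" "norm (u i n)" "y $ i"]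
          n x y by (simp add: V_def)
    qed
    also have "\<dots> = f n" by (simp add: f_def powr_minus_divide)
    finally show "dist x y \<le> f n" .
  next
    show "f n \<ge> 0" for n by (simp add: f_def)
    have "(\<lambda>n. real n powr - \<alpha>) \<longlonglongrightarrow> 0"
      using assms(2) by (intro tendsto_neg_powr filterlim_real_sequentially) auto
    then show "f \<longlonglongrightarrow> 0"
      unfolding f_def by (rule tendsto_mult_right_zero)
    \<comment> \<open>This is where \<open>s > 1 / \<alpha>\<close> enters: the exponent is below
      -1.\<close>
    have "summable (\<lambda>n. real n powr (- \<alpha> * s))"
      using s assms(2) by (simp add: summable_real_powr_iff field_simps)
    then show "summable (\<lambda>n. f n powr s)"
      by (simp add: f_def powr_mult powr_powr summable_mult)
  qed
qed

end
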